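(* The class of groups admitting pointy actions is closed under (finite) direct products, subgroups, and commensurability. That is: if $G$ and $H$ admit pointy actions then so does $G\times H$; if $G$ admits a pointy action then so does every subgroup of $G$; and if $G$ admits a pointy action and $H$ is commensurable to $G$ (i.e. $G$ and $H$ have isomorphic subgroups of finite index) then $H$ admits a pointy action.
   Context: For a finite alphabet $\Sigma$, the full shift $\Sigma^{\mathbb{Z}}$ carries the product topology and the shift homeomorphism $\sigma(x)_i = x_{i+1}$; $\mathrm{Aut}(\Sigma^{\mathbb{Z}})$ is the group of homeomorphisms of $\Sigma^{\mathbb{Z}}$ commuting with $\sigma$. If $\Sigma$ contains a distinguished symbol $0$, then $\mathrm{Aut}_0(\Sigma^{\mathbb{Z}})$ is the stabilizer of the constant point $0^{\mathbb{Z}}$ in $\mathrm{Aut}(\Sigma^{\mathbb{Z}})$, and $x\in\Sigma^{\mathbb{Z}}$ is $0$-finite if $\{i\in\mathbb{Z} : x_i\neq 0\}$ is finite. A subgroup $H\le \mathrm{Aut}_0(\Sigma^{\mathbb{Z}})$ is pointy if some $0$-finite $x_0\in\Sigma^{\mathbb{Z}}$ has free orbit under $H$, i.e. $h\mapsto hx_0$ is injective on $H$. A group $G$ admits a pointy action if, for some finite alphabet $\Sigma\ni 0$, there is an embedding of $G$ into $\mathrm{Aut}_0(\Sigma^{\mathbb{Z}})$ whose image is pointy. *)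

theory Defs
  imports "HOL-Analysis.Abstract_Topology" "HOL-Analysis.Function_Topology"
    "HOL-Algebra.Bij" "HOL-Algebra.Coset"
begin

definition full_shift :: "'a set \<Rightarrow> (int \<Rightarrow> 'a) topology" where
  "full_shift A = product_topology (\<lambda>_. discrete_topology A) UNIV"

definition shift :: "(int \<Rightarrow> 'a) \<Rightarrow> int \<Rightarrow> 'a" where
  "shift x = (\<lambda>i. x (i + 1))"

text \<open>
  The carrier of \<^term>\<open>BijGroup S\<close> consists of the bijections of \<open>S\<close> that are
  extensional (\<open>undefined\<close> outside \<open>S\<close>), so that each automorphism has exactly one
  representative; multiplication is composition.
\<close>

definition shift_Aut :: "'a set \<Rightarrow> ((int \<Rightarrow> 'a) \<Rightarrow> (int \<Rightarrow> 'a)) monoid" where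
  "shift_Aut A = BijGroup (topspace (full_shift A))
     \<lparr>carrier := {f \<in> Bij (topspace (full_shift A)).
        homeomorphic_map (full_shift A) (full_shift A) f \<and>
        (\<forall>x \<in> topspace (full_shift A). f (shift x) = shift (f x))}\<rparr>"

definition shift_Aut0 :: "'a set \<Rightarrow> 'a \<Rightarrow> ((int \<Rightarrow> 'a) \<Rightarrow> (int \<Rightarrow> 'a)) monoid" where
  "shift_Aut0 A z = shift_Aut A
     \<lparr>carrier := {f \<in> carrier (shift_Aut A). f (\<lambda>_. z) = (\<lambda>_. z)}\<rparr>"

definition finite_point :: "'a \<Rightarrow> (int \<Rightarrow> 'a) \<Rightarrow> bool" where
  "finite_point z x \<longleftrightarrow> finite {i. x i \<noteq> z}"

definition pointy :: "'a set \<Rightarrow> 'a \<Rightarrow> ((int \<Rightarrow> 'a) \<Rightarrow> (int \<Rightarrow> 'a)) set \<Rightarrow> bool" where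
  "pointy A z H \<longleftrightarrow> subgroup H (shift_Aut0 A z) \<and>
     (\<exists>x0 \<in> topspace (full_shift A). finite_point z x0 \<and> inj_on (\<lambda>h. h x0) H)"

text \<open>
  Types cannot be quantified existentially, so the alphabet ranges over the finite sets of
  natural numbers, with an arbitrary element as distinguished symbol. As every finite alphabet
  is in bijection with such a set, this is no restriction.
\<close>

definition admits_pointy_action :: "('g, 'm) monoid_scheme \<Rightarrow> bool" where
  "admits_pointy_action G \<longleftrightarrow>
     (\<exists>(A :: nat set) z \<phi>. finite A \<and> z \<in> A \<and>
        \<phi> \<in> mon G (shift_Aut0 A z) \<and> pointy A z (\<phi> ` carrier G))"

definition commensurable :: "('g, 'm) monoid_scheme \<Rightarrow> ('h, 'n) monoid_scheme \<Rightarrow> bool" where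
  "commensurable G H \<longleftrightarrow>
     (\<exists>K L. subgroup K G \<and> finite (rcosets\<^bsub>G\<^esub> K) \<and>
            subgroup L H \<and> finite (rcosets\<^bsub>H\<^esub> L) \<and>
            G\<lparr>carrier := K\<rparr> \<cong> H\<lparr>carrier := L\<rparr>)"

end

theory Submission
  imports Defs
begin

text \<open>
  Every construction below takes place on \<^emph>\<open>tracks\<close>: a configuration over a product alphabet
  is a tuple of configurations, and any way of letting a group permute the tracks while also
  acting on the individual tracks commutes with the shift and fixes the zero point.

  For \<open>G \<times> H\<close>, the two groups act on two separate tracks, and the pair of the two given points
  has free orbit. Passing to a subgroup is restriction of the action.

  For commensurability, restriction gives a pointy action of a finite-index subgroup \<open>L\<close> of \<open>H\<close>,
  and what remains is to extend it to \<open>H\<close>. This is done by inducing: \<open>H\<close> acts by right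
  translation, \<open>(g f)(h) = f(h g)\<close>, on the functions \<open>f\<close> from \<open>H\<close> to configurations with
  \<open>f(l h) = l f(h)\<close> for \<open>l \<in> L\<close>. Such a function is determined by its values on representatives
  of the finitely many cosets \<open>L h\<close>, so these functions correspond to the configurations over
  the finite alphabet \<open>A\<^sup>C\<close>, where \<open>C\<close> is the set of these cosets. If \<open>x0 \<noteq> 0\<close> has free orbit under \<open>L\<close>, put \<open>x0\<close> on the track of the coset \<open>L\<close>
  and \<open>0\<close> on all others: an element fixing this configuration cannot move the only nonzero
  track, so it is in \<open>L\<close>, and it is then trivial because \<open>L\<close> acts freely on \<open>x0\<close>. The point \<open>x0\<close>
  can be \<open>0\<close> only if \<open>L\<close> is trivial, as \<open>0\<close> is fixed by \<open>L\<close>; in that case the trivial action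
  on a two-letter alphabet replaces the given one.
\<close>

section \<open>Shift spaces and their automorphism groups\<close>

lemma topspace_full_shift_iff [simp]: "x \<in> topspace (full_shift A) \<longleftrightarrow> (\<forall>i. x i \<in> A)"
  by (auto simp: full_shift_def PiE_def Pi_def)

lemma shift_apply [simp]: "shift x i = x (i + 1)"
  by (simp add: shift_def)

lemma continuous_map_full_shift_iff:
  "continuous_map X (full_shift A) f \<longleftrightarrow> (\<forall>i. continuous_map X (discrete_topology A) (\<lambda>x. f x i))"
  by (simp add: full_shift_def continuous_map_componentwise_UNIV)

lemma continuous_map_letterwise:
  assumes "p \<in> A \<rightarrow> B"
  shows "continuous_map (full_shift A) (full_shift B) (\<lambda>x i. p (x i))"
  unfolding continuous_map_full_shift_iff
proof
  fix i
  have "continuous_map (full_shift A) (discrete_topology A) (\<lambda>x. x i)"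
    unfolding full_shift_def
    using continuous_map_product_projection[of i UNIV "\<lambda>_. discrete_topology A"] by simp
  moreover have "continuous_map (discrete_topology A) (discrete_topology B) p"
    using assms by (auto simp: continuous_map_def)
  ultimately show "continuous_map (full_shift A) (discrete_topology B) (\<lambda>x. p (x i))"
    using continuous_map_compose[of _ _ "\<lambda>x. x i" _ p] by (simp add: o_def)
qed

text \<open>
  A map into a shift over a compound alphabet may be checked on tracks: the preimage of a
  letter \<open>d\<close> is the intersection of the finitely many preimages of the components \<open>p k d\<close>.
\<close>

lemma continuous_map_tracks:
  assumes "finite K" "K \<noteq> {}"
    and sep: "\<And>d e. d \<in> D \<Longrightarrow> e \<in> D \<Longrightarrow> (\<And>k. k \<in> K \<Longrightarrow> p k d = p k e) \<Longrightarrow> d = e"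
    and cont: "\<And>k. k \<in> K \<Longrightarrow> continuous_map X (full_shift (B k)) (\<lambda>x i. p k (f x i))"
    and into: "\<And>x i. x \<in> topspace X \<Longrightarrow> f x i \<in> D"
  shows "continuous_map X (full_shift D) f"
  unfolding continuous_map_full_shift_iff
proof
  fix i
  have fibre: "openin X {x \<in> topspace X. f x i = d}" if "d \<in> D" for d
  proof -
    have "openin X {x \<in> topspace X. p k (f x i) = p k d}" if "k \<in> K" for k
    proof -
      have *: "continuous_map X (discrete_topology (B k)) (\<lambda>x. p k (f x i))"
        using cont[OF that] unfolding continuous_map_full_shift_iff by blast
      have "openin X {x \<in> topspace X. p k (f x i) \<in> {p k d} \<inter> B k}"
        using * by (rule openin_continuous_map_preimage) simp
      moreover have "{x \<in> topspace X. p k (f x i) \<in> {p k d} \<inter> B k} = {x \<in> topspace X. p k (f x i) = p k d}"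
        using continuous_map_image_subset_topspace[OF *] by auto
      ultimately show ?thesis by (simp only:)
    qed
    hence "openin X (\<Inter>k\<in>K. {x \<in> topspace X. p k (f x i) = p k d})"
      using assms(1,2) by (intro openin_Inter) auto
    moreover have "(\<Inter>k\<in>K. {x \<in> topspace X. p k (f x i) = p k d}) = {x \<in> topspace X. f x i = d}"
      using sep[OF into that] assms(2) by auto
    ultimately show ?thesis by simp
  qed
  have "openin X {x \<in> topspace X. f x i \<in> U}" if "U \<subseteq> D" for U
  proof -
    have "{x \<in> topspace X. f x i \<in> U} = (\<Union>d\<in>U. {x \<in> topspace X. f x i = d})" by auto
    thus ?thesis using fibre that by (auto intro!: openin_Union)
  qed
  thus "continuous_map X (discrete_topology D) (\<lambda>x. f x i)"
    using into by (auto simp: continuous_map_def)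
qed

lemma mem_shift_Aut0_iff:
  "f \<in> carrier (shift_Aut0 A z) \<longleftrightarrow>
     f \<in> Bij (topspace (full_shift A)) \<and> homeomorphic_map (full_shift A) (full_shift A) f \<and>
     (\<forall>x \<in> topspace (full_shift A). f (shift x) = shift (f x)) \<and> f (\<lambda>_. z) = (\<lambda>_. z)"
  by (auto simp: shift_Aut0_def shift_Aut_def)

lemma mult_shift_Aut0:
  assumes "f \<in> Bij (topspace (full_shift A))" "g \<in> Bij (topspace (full_shift A))"
  shows "f \<otimes>\<^bsub>shift_Aut0 A z\<^esub> g = compose (topspace (full_shift A)) f g"
  using assms by (simp add: shift_Aut0_def shift_Aut_def BijGroup_def)

lemma one_shift_Aut0: "\<one>\<^bsub>shift_Aut0 A z\<^esub> = (\<lambda>x\<in>topspace (full_shift A). x)"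
  by (simp add: shift_Aut0_def shift_Aut_def BijGroup_def)

lemma group_shift_Aut0:
  assumes "z \<in> A"
  shows "group (shift_Aut0 A z)"
proof (rule groupI)
  let ?X = "topspace (full_shift A)"
  have zX: "(\<lambda>_. z) \<in> ?X" using assms by simp
  have shX: "shift x \<in> ?X" if "x \<in> ?X" for x using that by simp
  {
    fix f g assume f: "f \<in> carrier (shift_Aut0 A z)" and g: "g \<in> carrier (shift_Aut0 A z)"
    have fB: "f \<in> Bij ?X" "g \<in> Bij ?X" using f g by (auto simp: mem_shift_Aut0_iff)
    have gX: "g x \<in> ?X" if "x \<in> ?X" for x using Bij_imp_funcset[OF fB(2)] that by blast
    have "homeomorphic_map (full_shift A) (full_shift A) (f \<circ> g)"
      using f g by (auto simp: mem_shift_Aut0_iff intro: homeomorphic_map_compose)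
    hence "homeomorphic_map (full_shift A) (full_shift A) (compose ?X f g)"
      by (rule homeomorphic_map_eq) (simp add: compose_def)
    moreover have "compose ?X f g (shift x) = shift (compose ?X f g x)" if "x \<in> ?X" for x
      using f g that gX[OF that] shX[OF that] by (simp add: compose_eq mem_shift_Aut0_iff)
    moreover have "compose ?X f g (\<lambda>_. z) = (\<lambda>_. z)"
      using f g zX by (simp add: compose_eq mem_shift_Aut0_iff)
    ultimately show "f \<otimes>\<^bsub>shift_Aut0 A z\<^esub> g \<in> carrier (shift_Aut0 A z)"
      using fB by (simp add: mult_shift_Aut0 mem_shift_Aut0_iff compose_Bij del: topspace_full_shift_iff)
  }
  note closed = this
  have "homeomorphic_map (full_shift A) (full_shift A) (\<lambda>x\<in>?X. x)"
    by (rule homeomorphic_map_eq[OF homeomorphic_map_id[THEN iffD2]]) simp_all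
  thus one: "\<one>\<^bsub>shift_Aut0 A z\<^esub> \<in> carrier (shift_Aut0 A z)"
    using shX zX by (simp add: one_shift_Aut0 mem_shift_Aut0_iff id_Bij)
  show "f \<otimes>\<^bsub>shift_Aut0 A z\<^esub> g \<otimes>\<^bsub>shift_Aut0 A z\<^esub> h = f \<otimes>\<^bsub>shift_Aut0 A z\<^esub> (g \<otimes>\<^bsub>shift_Aut0 A z\<^esub> h)"
    if "f \<in> carrier (shift_Aut0 A z)" "g \<in> carrier (shift_Aut0 A z)"
      "h \<in> carrier (shift_Aut0 A z)" for f g h
    using that
    by (simp add: mult_shift_Aut0 mem_shift_Aut0_iff compose_Bij Bij_imp_funcset
        compose_assoc[symmetric] del: topspace_full_shift_iff)
  show "\<one>\<^bsub>shift_Aut0 A z\<^esub> \<otimes>\<^bsub>shift_Aut0 A z\<^esub> f = f" if "f \<in> carrier (shift_Aut0 A z)" for f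
    using that
    by (simp add: one_shift_Aut0 mult_shift_Aut0 mem_shift_Aut0_iff id_Bij Bij_imp_funcset
        Bij_imp_extensional del: topspace_full_shift_iff)
  show "\<exists>g\<in>carrier (shift_Aut0 A z). g \<otimes>\<^bsub>shift_Aut0 A z\<^esub> f = \<one>\<^bsub>shift_Aut0 A z\<^esub>"
    if f: "f \<in> carrier (shift_Aut0 A z)" for f
  proof
    let ?g = "restrict (inv_into ?X f) ?X"
    have fB: "f \<in> Bij ?X" using f by (simp add: mem_shift_Aut0_iff)
    hence inj: "inj_on f ?X" and im: "f ` ?X = ?X" by (auto simp: Bij_def bij_betw_def)
    have gB: "?g \<in> Bij ?X" using fB by (rule restrict_inv_into_Bij)
    have gX: "?g x \<in> ?X" if "x \<in> ?X" for x using Bij_imp_funcset[OF gB] that by blast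
    have fg: "f (?g x) = x" if "x \<in> ?X" for x using that im by (simp add: f_inv_into_f del: topspace_full_shift_iff)
    have gf: "?g (f x) = x" if "x \<in> ?X" for x
      using that im inj by (metis imageI inv_into_f_f restrict_apply')
    obtain k where k: "homeomorphic_maps (full_shift A) (full_shift A) f k"
      using f by (auto simp: mem_shift_Aut0_iff homeomorphic_map_maps)
    hence hk: "homeomorphic_map (full_shift A) (full_shift A) k"
      using homeomorphic_maps_map by blast
    have kg: "k x = ?g x" if "x \<in> ?X" for x
    proof -
      have "k (f (?g x)) = ?g x" using k gX[OF that] unfolding homeomorphic_maps_def by blast
      thus ?thesis using fg[OF that] by simp
    qed
    have "homeomorphic_map (full_shift A) (full_shift A) ?g"
      using hk kg by (rule homeomorphic_map_eq)
    moreover have "?g (shift x) = shift (?g x)" if "x \<in> ?X" for x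
    proof -
      have "f (shift (?g x)) = shift x"
        using f gX[OF that] fg[OF that] by (metis mem_shift_Aut0_iff)
      thus ?thesis using gf[OF shX[OF gX[OF that]]] by simp
    qed
    moreover have "?g (\<lambda>_. z) = (\<lambda>_. z)"
    proof -
      have "f (\<lambda>_. z) = (\<lambda>_. z)" using f by (simp add: mem_shift_Aut0_iff)
      thus ?thesis using gf[OF zX] by (simp only:)
    qed
    ultimately show "?g \<in> carrier (shift_Aut0 A z)"
      using gB by (simp add: mem_shift_Aut0_iff del: topspace_full_shift_iff)
    show "?g \<otimes>\<^bsub>shift_Aut0 A z\<^esub> f = \<one>\<^bsub>shift_Aut0 A z\<^esub>"
      using fB gB by (simp add: mult_shift_Aut0 one_shift_Aut0 Bij_compose_restrict_eq)
  qed
qed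

section \<open>Pointy actions on arbitrary alphabets\<close>

text \<open>
  A pointy action written as an explicit action on configurations. The alphabet may have any
  type, so that products and powers of alphabets can be used as they are, and the maps
  \<open>\<rho> g\<close> are constrained only on the configurations over \<open>A\<close>. Freeness of the orbit of \<open>x0\<close> is
  stated as triviality of its stabilizer.
\<close>

locale pointy_act = group G for G (structure) +
  fixes A :: "'a set" and z :: 'a and \<rho> :: "'g \<Rightarrow> (int \<Rightarrow> 'a) \<Rightarrow> int \<Rightarrow> 'a" and x0 :: "int \<Rightarrow> 'a"
  assumes finite_alphabet: "finite A"
    and zero_in: "z \<in> A"
    and cont: "g \<in> carrier G \<Longrightarrow> continuous_map (full_shift A) (full_shift A) (\<rho> g)"
    and shift_commute: "\<lbrakk>g \<in> carrier G; x \<in> topspace (full_shift A)\<rbrakk> \<Longrightarrow> \<rho> g (shift x) = shift (\<rho> g x)"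
    and fix_zero: "g \<in> carrier G \<Longrightarrow> \<rho> g (\<lambda>_. z) = (\<lambda>_. z)"
    and act_one: "x \<in> topspace (full_shift A) \<Longrightarrow> \<rho> \<one> x = x"
    and act_mult: "\<lbrakk>g \<in> carrier G; h \<in> carrier G; x \<in> topspace (full_shift A)\<rbrakk>
                     \<Longrightarrow> \<rho> (g \<otimes> h) x = \<rho> g (\<rho> h x)"
    and point_in: "x0 \<in> topspace (full_shift A)"
    and point_finite: "finite_point z x0"
    and stabilizer: "\<lbrakk>g \<in> carrier G; \<rho> g x0 = x0\<rbrakk> \<Longrightarrow> g = \<one>"
begin

lemma act_closed: "\<lbrakk>g \<in> carrier G; x \<in> topspace (full_shift A)\<rbrakk> \<Longrightarrow> \<rho> g x \<in> topspace (full_shift A)"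
  using continuous_map_image_subset_topspace[OF cont] by blast

lemma zero_point_in: "(\<lambda>_. z) \<in> topspace (full_shift A)"
  using zero_in by simp

lemma act_inv:
  assumes "g \<in> carrier G" "x \<in> topspace (full_shift A)"
  shows "\<rho> (inv g) (\<rho> g x) = x" "\<rho> g (\<rho> (inv g) x) = x"
  using assms by (simp_all flip: act_mult add: act_one del: topspace_full_shift_iff)

lemma free_orbit: "inj_on (\<lambda>g. \<rho> g x0) (carrier G)"
proof (rule inj_onI)
  fix g h assume gh: "g \<in> carrier G" "h \<in> carrier G" "\<rho> g x0 = \<rho> h x0"
  have "\<rho> (inv h \<otimes> g) x0 = x0"
    using gh act_inv[OF _ point_in] act_mult[OF _ _ point_in] by simp
  hence "inv h \<otimes> g = \<one>" using gh stabilizer by simp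
  thus "g = h" using gh by (metis inv_equality inv_inv inv_closed)
qed

lemma homeomorphic_map_act:
  assumes "g \<in> carrier G"
  shows "homeomorphic_map (full_shift A) (full_shift A) (\<rho> g)"
proof -
  have "homeomorphic_maps (full_shift A) (full_shift A) (\<rho> g) (\<rho> (inv g))"
    using assms cont act_inv by (simp add: homeomorphic_maps_def del: topspace_full_shift_iff)
  thus ?thesis using homeomorphic_map_maps by blast
qed

text \<open>Pulling back along an injective homomorphism covers both subgroups and isomorphic copies.\<close>

lemma pullback:
  assumes "group K" "f \<in> hom K G" "inj_on f (carrier K)"
  shows "pointy_act K A z (\<rho> \<circ> f) x0"
proof -
  interpret K: group_hom K G f
    using assms is_group by (simp add: group_hom_def group_hom_axioms_def)
  show ?thesis
  proof (rule pointy_act.intro[OF assms(1)], unfold_locales)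
    fix k assume k: "k \<in> carrier K" "(\<rho> \<circ> f) k x0 = x0"
    hence "f k = f \<one>\<^bsub>K\<^esub>" using stabilizer by simp
    thus "k = \<one>\<^bsub>K\<^esub>" using k assms(3) by (simp add: inj_on_def)
  qed (use finite_alphabet zero_in cont shift_commute fix_zero act_one act_mult point_in point_finite
      in \<open>simp_all del: topspace_full_shift_iff\<close>)
qed

text \<open>
  The alphabet matters only up to bijection: decode, act, and encode again. With a bijection onto
  an initial segment of the natural numbers this leads back to \<^const>\<open>admits_pointy_action\<close>.
\<close>

lemma rename_alphabet:
  assumes e: "bij_betw e A B"
  shows "\<exists>\<rho>' x0'. pointy_act G B (e z) \<rho>' x0'"
proof -
  define d where "d = inv_into A e"
  have de: "d (e a) = a" if "a \<in> A" for a
    using that e by (simp add: d_def bij_betw_inv_into_left)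
  have ed: "e (d b) = b" if "b \<in> B" for b
    using that e by (simp add: d_def bij_betw_inv_into_right)
  have eA: "e a \<in> B" if "a \<in> A" for a using that e by (auto simp: bij_betw_def)
  have dB: "d b \<in> A" if "b \<in> B" for b
    using that e bij_betw_inv_into[OF e] by (auto simp: d_def bij_betw_def)
  define dec where "dec = (\<lambda>y::int \<Rightarrow> _. \<lambda>i. d (y i))"
  define \<rho>' where "\<rho>' = (\<lambda>g y i. e (\<rho> g (dec y) i))"
  have decX: "dec y \<in> topspace (full_shift A)" if "y \<in> topspace (full_shift B)" for y
    using that dB by (simp add: dec_def)
  have dec_enc: "dec (\<lambda>i. e (x i)) = x" if "x \<in> topspace (full_shift A)" for x
    using that de by (simp add: dec_def)
  have dec_act: "dec (\<rho>' g y) = \<rho> g (dec y)"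
    if "g \<in> carrier G" "y \<in> topspace (full_shift B)" for g y
    using act_closed[OF that(1) decX[OF that(2)]] dec_enc by (simp add: \<rho>'_def)
  have "pointy_act G B (e z) \<rho>' (\<lambda>i. e (x0 i))"
  proof (rule pointy_act.intro[OF is_group], unfold_locales)
    show "finite B" using finite_alphabet e bij_betw_finite by blast
    show "e z \<in> B" using zero_in eA by simp
    have "continuous_map (full_shift B) (full_shift A) dec"
      unfolding dec_def using dB by (intro continuous_map_letterwise) auto
    moreover have "continuous_map (full_shift A) (full_shift B) (\<lambda>x i. e (x i))"
      using eA by (intro continuous_map_letterwise) auto
    ultimately show "continuous_map (full_shift B) (full_shift B) (\<rho>' g)" if "g \<in> carrier G" for g
      using continuous_map_compose[OF continuous_map_compose[OF _ cont[OF that]]]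
      by (fastforce simp: \<rho>'_def o_def)
    show "\<rho>' g (shift y) = shift (\<rho>' g y)"
      if "g \<in> carrier G" "y \<in> topspace (full_shift B)" for g y
    proof -
      have "dec (shift y) = shift (dec y)" by (simp add: dec_def fun_eq_iff)
      thus ?thesis using shift_commute[OF that(1) decX[OF that(2)]]
        by (simp add: \<rho>'_def shift_def)
    qed
    have "dec (\<lambda>_. e z) = (\<lambda>_. z)" using de[OF zero_in] by (simp add: dec_def)
    thus "\<rho>' g (\<lambda>_. e z) = (\<lambda>_. e z)" if "g \<in> carrier G" for g
      using fix_zero[OF that] by (simp add: \<rho>'_def)
    show "\<rho>' \<one> y = y" if "y \<in> topspace (full_shift B)" for y
      using act_one[OF decX[OF that]] that ed by (simp add: \<rho>'_def) (simp add: dec_def)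
    show "\<rho>' (g \<otimes> h) y = \<rho>' g (\<rho>' h y)"
      if "g \<in> carrier G" "h \<in> carrier G" "y \<in> topspace (full_shift B)" for g h y
      using act_mult[OF that(1,2) decX[OF that(3)]] dec_act[OF that(2,3)]
      by (simp add: \<rho>'_def)
    show "(\<lambda>i. e (x0 i)) \<in> topspace (full_shift B)" using point_in eA by simp
    show "finite_point (e z) (\<lambda>i. e (x0 i))"
      using point_finite unfolding finite_point_def by (rule rev_finite_subset) auto
    show "g = \<one>" if g: "g \<in> carrier G" "\<rho>' g (\<lambda>i. e (x0 i)) = (\<lambda>i. e (x0 i))" for g
    proof -
      have "(\<lambda>i. e (x0 i)) \<in> topspace (full_shift B)" using point_in eA by simp
      from dec_act[OF g(1) this] have "\<rho> g x0 = x0"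
        unfolding g(2) dec_enc[OF point_in] by simp
      thus ?thesis by (rule stabilizer[OF g(1)])
    qed
  qed
  thus ?thesis by blast
qed

end

lemma admits_pointy_action_of_nat_alphabet:
  fixes G (structure) and A :: "nat set"
  assumes "pointy_act G A z \<rho> x0"
  shows "admits_pointy_action G"
proof -
  interpret pointy_act G A z \<rho> x0 by (rule assms)
  let ?X = "topspace (full_shift A)"
  define \<phi> where "\<phi> = (\<lambda>g. restrict (\<rho> g) ?X)"
  have \<phi>B: "\<phi> g \<in> Bij ?X" if "g \<in> carrier G" for g
  proof -
    have "bij_betw (\<rho> g) ?X ?X"
      using act_closed[OF that] act_closed[OF inv_closed[OF that]] act_inv[OF that]
      by (intro bij_betw_byWitness[where f' = "\<rho> (inv g)"]) (auto simp del: topspace_full_shift_iff)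
    thus ?thesis by (simp add: \<phi>_def Bij_def)
  qed
  have \<phi>_in: "\<phi> g \<in> carrier (shift_Aut0 A z)" if "g \<in> carrier G" for g
  proof -
    have "homeomorphic_map (full_shift A) (full_shift A) (\<phi> g)"
      by (rule homeomorphic_map_eq[OF homeomorphic_map_act[OF that]])
        (simp add: \<phi>_def del: topspace_full_shift_iff)
    moreover have "shift x \<in> ?X" if "x \<in> ?X" for x using that by simp
    ultimately show ?thesis
      using \<phi>B[OF that] shift_commute[OF that] fix_zero[OF that] zero_point_in
      by (simp add: mem_shift_Aut0_iff \<phi>_def del: topspace_full_shift_iff)
  qed
  have hom: "\<phi> \<in> hom G (shift_Aut0 A z)"
  proof (rule homI)
    fix g h assume gh: "g \<in> carrier G" "h \<in> carrier G"
    have "\<phi> (g \<otimes> h) = compose ?X (\<phi> g) (\<phi> h)"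
      unfolding \<phi>_def compose_def
      using gh act_mult act_closed by (intro restrict_ext) (simp del: topspace_full_shift_iff)
    thus "\<phi> (g \<otimes> h) = \<phi> g \<otimes>\<^bsub>shift_Aut0 A z\<^esub> \<phi> h"
      using \<phi>B gh by (simp add: mult_shift_Aut0)
  qed (rule \<phi>_in)
  have orbit: "\<phi> g x0 = \<rho> g x0" for g using point_in by (simp add: \<phi>_def del: topspace_full_shift_iff)
  have inj: "inj_on \<phi> (carrier G)"
    using free_orbit by (auto simp: inj_on_def simp flip: orbit)
  interpret group_hom G "shift_Aut0 A z" \<phi>
    using hom group_shift_Aut0[OF zero_in] is_group by (simp add: group_hom_def group_hom_axioms_def)
  have "inj_on (\<lambda>h. h x0) (\<phi> ` carrier G)"
    using free_orbit by (auto simp: inj_on_def orbit)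
  hence "pointy A z (\<phi> ` carrier G)"
    unfolding pointy_def using img_is_subgroup point_in point_finite by blast
  thus ?thesis
    unfolding admits_pointy_action_def mon_def
    using finite_alphabet zero_in hom inj by blast
qed

lemma admits_pointy_action_of_pointy_act:
  assumes "pointy_act G A z \<rho> x0"
  shows "admits_pointy_action G"
proof -
  obtain e where "bij_betw e A {0..<card A}"
    using ex_bij_betw_finite_nat[OF pointy_act.finite_alphabet[OF assms]] by blast
  thus ?thesis
    using pointy_act.rename_alphabet[OF assms] admits_pointy_action_of_nat_alphabet by blast
qed

lemma pointy_act_of_admits_pointy_action:
  assumes "group G" "admits_pointy_action G"
  obtains A :: "nat set" and z \<rho> x0 where "pointy_act G A z \<rho> x0"
proof -
  obtain A :: "nat set" and z \<phi> x0 where A: "finite A" "z \<in> A"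
    and \<phi>: "\<phi> \<in> hom G (shift_Aut0 A z)" "inj_on \<phi> (carrier G)"
    and x0: "x0 \<in> topspace (full_shift A)" "finite_point z x0"
    and inj: "inj_on (\<lambda>h. h x0) (\<phi> ` carrier G)"
    using assms(2) unfolding admits_pointy_action_def mon_def pointy_def by blast
  interpret \<phi>: group_hom G "shift_Aut0 A z" \<phi>
    using \<phi>(1) group_shift_Aut0[OF A(2)] assms(1) by (simp add: group_hom_def group_hom_axioms_def)
  have mem: "\<phi> g \<in> Bij (topspace (full_shift A))" "homeomorphic_map (full_shift A) (full_shift A) (\<phi> g)"
    "\<forall>x \<in> topspace (full_shift A). \<phi> g (shift x) = shift (\<phi> g x)" "\<phi> g (\<lambda>_. z) = (\<lambda>_. z)"
    if "g \<in> carrier G" for g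
    using \<phi>.hom_closed[OF that] unfolding mem_shift_Aut0_iff by blast+
  have one: "\<phi> \<one>\<^bsub>G\<^esub> x = x" if "x \<in> topspace (full_shift A)" for x
    using that by (simp add: one_shift_Aut0)
  have "pointy_act G A z \<phi> x0"
  proof (rule pointy_act.intro[OF assms(1)], unfold_locales)
    show "continuous_map (full_shift A) (full_shift A) (\<phi> g)" if "g \<in> carrier G" for g
      using mem(2)[OF that] by (rule homeomorphic_imp_continuous_map)
    show "\<phi> (g \<otimes>\<^bsub>G\<^esub> h) x = \<phi> g (\<phi> h x)"
      if "g \<in> carrier G" "h \<in> carrier G" "x \<in> topspace (full_shift A)" for g h x
      using that mem(1) by (simp add: mult_shift_Aut0 compose_eq del: topspace_full_shift_iff)
    show "g = \<one>\<^bsub>G\<^esub>" if "g \<in> carrier G" "\<phi> g x0 = x0" for g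
    proof -
      have "\<phi> g x0 = \<phi> \<one>\<^bsub>G\<^esub> x0" using that one[OF x0(1)] by simp
      hence "\<phi> g = \<phi> \<one>\<^bsub>G\<^esub>" using inj that(1) \<phi>.G.one_closed by (metis (mono_tags, lifting) imageI inj_onD)
      thus ?thesis using \<phi>(2) that(1) \<phi>.G.one_closed by (metis inj_onD)
    qed
  qed (use A x0 mem one in auto)
  thus thesis by (rule that)
qed

section \<open>Direct products\<close>

lemma pointy_act_DirProd:
  fixes A B :: "'a set"
  assumes "pointy_act G A a \<rho> x0" "pointy_act H B b \<tau> y0"
  shows "pointy_act (G \<times>\<times> H) (A \<times> B) (a, b)
           (\<lambda>(g, h) x i. (\<rho> g (\<lambda>i. fst (x i)) i, \<tau> h (\<lambda>i. snd (x i)) i)) (\<lambda>i. (x0 i, y0 i))"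
proof -
  interpret G: pointy_act G A a \<rho> x0 by (rule assms)
  interpret H: pointy_act H B b \<tau> y0 by (rule assms)
  define \<sigma> where "\<sigma> = (\<lambda>(g, h) x i. (\<rho> g (\<lambda>i. fst (x i)) i, \<tau> h (\<lambda>i. snd (x i)) i))"
  let ?X = "full_shift (A \<times> B)"
  have fst\<sigma>: "(\<lambda>i. fst (\<sigma> k x i)) = \<rho> (fst k) (\<lambda>i. fst (x i))"
    and snd\<sigma>: "(\<lambda>i. snd (\<sigma> k x i)) = \<tau> (snd k) (\<lambda>i. snd (x i))" for k x
    by (simp_all add: \<sigma>_def split: prod.split)
  have eqI: "x = y" if "(\<lambda>i. fst (x i)) = (\<lambda>i. fst (y i))" "(\<lambda>i. snd (x i)) = (\<lambda>i. snd (y i))"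
    for x y :: "int \<Rightarrow> 'a \<times> 'a"
    using that by (auto simp: fun_eq_iff prod_eq_iff)
  have fstX: "(\<lambda>i. fst (x i)) \<in> topspace (full_shift A)"
    and sndX: "(\<lambda>i. snd (x i)) \<in> topspace (full_shift B)" if "x \<in> topspace ?X" for x
    using that by (auto simp: mem_Times_iff)
  have "pointy_act (G \<times>\<times> H) (A \<times> B) (a, b) \<sigma> (\<lambda>i. (x0 i, y0 i))"
  proof (rule pointy_act.intro[OF DirProd_group[OF G.is_group H.is_group]], unfold_locales)
    show "finite (A \<times> B)" using G.finite_alphabet H.finite_alphabet by simp
    show "(a, b) \<in> A \<times> B" using G.zero_in H.zero_in by simp
    show "continuous_map ?X ?X (\<sigma> k)" if "k \<in> carrier (G \<times>\<times> H)" for k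
    proof (rule continuous_map_tracks[where K = UNIV and p = "\<lambda>b. if b then fst else snd"
          and B = "\<lambda>b. if b then A else B"])
      have k: "fst k \<in> carrier G" "snd k \<in> carrier H" using that by auto
      have "continuous_map ?X (full_shift A) (\<lambda>x i. fst (x i))"
        "continuous_map ?X (full_shift B) (\<lambda>x i. snd (x i))"
        by (auto intro!: continuous_map_letterwise)
      hence "continuous_map ?X (full_shift A) (\<lambda>x i. fst (\<sigma> k x i))"
        "continuous_map ?X (full_shift B) (\<lambda>x i. snd (\<sigma> k x i))"
        using continuous_map_compose[OF _ G.cont[OF k(1)]] continuous_map_compose[OF _ H.cont[OF k(2)]]
        by (fastforce simp: fst\<sigma> snd\<sigma> o_def)+
      thus "continuous_map ?X (full_shift (if b then A else B))
          (\<lambda>x i. (if b then fst else snd) (\<sigma> k x i))" for b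
        by (cases b) simp_all
      show "\<sigma> k x i \<in> A \<times> B" if "x \<in> topspace ?X" for x i
        using G.act_closed[OF k(1) fstX[OF that]] H.act_closed[OF k(2) sndX[OF that]]
        by (simp add: \<sigma>_def case_prod_beta)
      show "d = e" if "\<And>b. b \<in> UNIV \<Longrightarrow> (if b then fst else snd) d = (if b then fst else snd) e"
        for d e :: "'a \<times> 'a"
        using that[of True] that[of False] by (simp add: prod_eq_iff)
    qed auto
    show "\<sigma> k (shift x) = shift (\<sigma> k x)"
      if "k \<in> carrier (G \<times>\<times> H)" "x \<in> topspace ?X" for k x
      using that G.shift_commute[OF _ fstX[OF that(2)]] H.shift_commute[OF _ sndX[OF that(2)]]
      by (auto simp: \<sigma>_def shift_def)
    show "\<sigma> k (\<lambda>_. (a, b)) = (\<lambda>_. (a, b))" if "k \<in> carrier (G \<times>\<times> H)" for k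
      using that G.fix_zero H.fix_zero by (auto simp: \<sigma>_def)
    show "\<sigma> \<one>\<^bsub>G \<times>\<times> H\<^esub> x = x" if "x \<in> topspace ?X" for x
      using G.act_one[OF fstX[OF that]] H.act_one[OF sndX[OF that]] by (simp add: \<sigma>_def)
    show "\<sigma> (k \<otimes>\<^bsub>G \<times>\<times> H\<^esub> l) x = \<sigma> k (\<sigma> l x)"
      if "k \<in> carrier (G \<times>\<times> H)" "l \<in> carrier (G \<times>\<times> H)" "x \<in> topspace ?X" for k l x
      using that G.act_mult[OF _ _ fstX[OF that(3)]] H.act_mult[OF _ _ sndX[OF that(3)]]
      by (intro eqI) (auto simp: fst\<sigma> snd\<sigma> mult_DirProd')
    show "(\<lambda>i. (x0 i, y0 i)) \<in> topspace ?X" using G.point_in H.point_in by simp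
    have "{i. (x0 i, y0 i) \<noteq> (a, b)} = {i. x0 i \<noteq> a} \<union> {i. y0 i \<noteq> b}" by auto
    thus "finite_point (a, b) (\<lambda>i. (x0 i, y0 i))"
      using G.point_finite H.point_finite by (simp add: finite_point_def)
    show "k = \<one>\<^bsub>G \<times>\<times> H\<^esub>"
      if k: "k \<in> carrier (G \<times>\<times> H)" and fixed: "\<sigma> k (\<lambda>i. (x0 i, y0 i)) = (\<lambda>i. (x0 i, y0 i))" for k
    proof -
      have "\<rho> (fst k) x0 = x0" "\<tau> (snd k) y0 = y0"
        using fst\<sigma>[of k "\<lambda>i. (x0 i, y0 i)"] snd\<sigma>[of k "\<lambda>i. (x0 i, y0 i)"] by (simp_all add: fixed)
      thus ?thesis using k G.stabilizer H.stabilizer by (auto simp: prod_eq_iff)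
    qed
  qed
  thus ?thesis by (simp only: \<sigma>_def)
qed

section \<open>Induction from a subgroup of finite index\<close>

text \<open>
  The zero point is fixed by the whole group, so its orbit can be free only if the group is
  trivial. The trivial group has a nonzero point with free orbit over any alphabet that has a
  nonzero letter.
\<close>

lemma pointy_act_nonzero_point:
  fixes A :: "nat set"
  assumes "pointy_act G A z \<rho> x0"
  obtains B :: "nat set" and w \<tau> y0 where "pointy_act G B w \<tau> y0" "y0 \<noteq> (\<lambda>_. w)"
proof (cases "x0 = (\<lambda>_. z)")
  case True
  interpret pointy_act G A z \<rho> x0 by (rule assms)
  have trivial: "g = \<one>\<^bsub>G\<^esub>" if "g \<in> carrier G" for g
    using stabilizer[OF that] fix_zero[OF that] True by simp
  let ?y = "\<lambda>i::int. if i = 0 then 1 else (0::nat)"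
  have "pointy_act G {0, 1} 0 (\<lambda>g x. x) ?y"
    by (rule pointy_act.intro[OF is_group], unfold_locales)
      (use trivial in \<open>simp_all add: finite_point_def\<close>)
  moreover have "?y \<noteq> (\<lambda>_. 0)" by (metis zero_neq_one)
  ultimately show thesis by (rule that)
next
  case False
  thus thesis using assms that by blast
qed

text \<open>
  \<open>extend F\<close> is the \<open>L\<close>-equivariant function on \<open>G\<close> whose value at the chosen representative of
  a coset \<open>c\<close> is \<open>F c\<close>. The group acts on such functions by right translation; \<open>induced\<close> is this
  action read off on the representatives, the new letter at \<open>i\<close> collecting the letters at \<open>i\<close> of all
  the tracks.
\<close>

locale finite_index_pointy_act =
  group G + L: subgroup L G + act: pointy_act "G\<lparr>carrier := L\<rparr>" A z \<rho> x0
  for G (structure) and L A z \<rho> x0 +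
  assumes finite_index: "finite (rcosets L)"
begin

definition rep :: "'a set \<Rightarrow> 'a" where
  "rep c = (SOME h. h \<in> c)"

definition extend :: "('a set \<Rightarrow> int \<Rightarrow> 'c) \<Rightarrow> 'a \<Rightarrow> int \<Rightarrow> 'c" where
  "extend F h = \<rho> (h \<otimes> inv (rep (L #> h))) (F (L #> h))"

definition induced :: "'a \<Rightarrow> (int \<Rightarrow> 'a set \<Rightarrow> 'c) \<Rightarrow> int \<Rightarrow> 'a set \<Rightarrow> 'c" where
  "induced g x = (\<lambda>i. \<lambda>c\<in>rcosets L. extend (\<lambda>c i. x i c) (rep c \<otimes> g) i)"

abbreviation tracks where
  "tracks x \<equiv> (\<lambda>c i. x i c)"

lemma
  assumes "c \<in> rcosets L"
  shows rep_carrier: "rep c \<in> carrier G" and coset_rep: "L #> rep c = c"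
proof -
  have "rep c \<in> c"
    unfolding rep_def using L.rcosets_non_empty[OF assms] by (simp only: some_in_eq not_False_eq_True)
  moreover obtain h where h: "h \<in> carrier G" "c = L #> h" using assms by (auto simp: RCOSETS_def)
  ultimately show "rep c \<in> carrier G" "L #> rep c = c"
    using L.elemrcos_carrier[OF is_group] repr_independence[OF _ _ L.subgroup_axioms] by auto
qed

lemma coset_in: "h \<in> carrier G \<Longrightarrow> L #> h \<in> rcosets L"
  by (rule rcosetsI[OF L.subset])

lemma cocycle_in:
  assumes "h \<in> carrier G"
  shows "h \<otimes> inv (rep (L #> h)) \<in> L"
proof (rule L.rcos_module_imp[OF is_group])
  show "rep (L #> h) \<in> carrier G" by (rule rep_carrier[OF coset_in[OF assms]])
  show "h \<in> L #> rep (L #> h)"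
    using rcos_self[OF assms L.subgroup_axioms] coset_rep[OF coset_in[OF assms]] by simp
qed

lemma extend_in:
  assumes "h \<in> carrier G" "\<And>c. c \<in> rcosets L \<Longrightarrow> F c \<in> topspace (full_shift A)"
  shows "extend F h \<in> topspace (full_shift A)"
  unfolding extend_def using cocycle_in[OF assms(1)] assms(2)[OF coset_in[OF assms(1)]]
  by (intro act.act_closed) simp_all

text \<open>
  The elements \<open>h\<close> and \<open>l \<otimes> h\<close> share their coset, hence their representative, and the factors in
  \<open>L\<close> that separate them from it differ by \<open>l\<close>.
\<close>

lemma extend_equivariant:
  assumes "l \<in> L" "h \<in> carrier G" "\<And>c. c \<in> rcosets L \<Longrightarrow> F c \<in> topspace (full_shift A)"
  shows "extend F (l \<otimes> h) = \<rho> l (extend F h)"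
proof -
  have l: "l \<in> carrier G" using assms(1) L.subset by blast
  have coset: "L #> (l \<otimes> h) = L #> h"
    using coset_mult_assoc[OF L.subset l assms(2)] L.rcos_const[OF is_group assms(1)] by simp
  have "l \<otimes> h \<otimes> inv (rep (L #> h)) = l \<otimes> (h \<otimes> inv (rep (L #> h)))"
    using l assms(2) rep_carrier[OF coset_in[OF assms(2)]] by (simp add: m_assoc)
  thus ?thesis
    unfolding extend_def coset
    using act.act_mult[of l "h \<otimes> inv (rep (L #> h))" "F (L #> h)"] assms(1)
      cocycle_in[OF assms(2)] assms(3)[OF coset_in[OF assms(2)]]
    by simp
qed

lemma extend_rep:
  assumes "c \<in> rcosets L" "F c \<in> topspace (full_shift A)"
  shows "extend F (rep c) = F c"
  using act.act_one[OF assms(2)] rep_carrier[OF assms(1)]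
  by (simp add: extend_def coset_rep[OF assms(1)])

lemma tracks_in:
  assumes "x \<in> topspace (full_shift (rcosets L \<rightarrow>\<^sub>E A))" "c \<in> rcosets L"
  shows "tracks x c \<in> topspace (full_shift A)"
  using assms by auto

lemma tracks_induced:
  "c \<in> rcosets L \<Longrightarrow> tracks (induced g x) c = extend (tracks x) (rep c \<otimes> g)"
  by (simp add: induced_def)

text \<open>
  By definition \<open>induced g\<close> is right translation by \<open>g\<close> on the representatives, and equivariance
  propagates this to all of \<open>G\<close>. This is why \<open>induced\<close> is an action: right translations
  compose as they should.
\<close>

lemma extend_induced:
  assumes "h \<in> carrier G" "g \<in> carrier G" "x \<in> topspace (full_shift (rcosets L \<rightarrow>\<^sub>E A))"
  shows "extend (tracks (induced g x)) h = extend (tracks x) (h \<otimes> g)"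
proof -
  let ?r = "rep (L #> h)"
  have r: "?r \<in> carrier G" by (rule rep_carrier[OF coset_in[OF assms(1)]])
  have "extend (tracks (induced g x)) h = \<rho> (h \<otimes> inv ?r) (extend (tracks x) (?r \<otimes> g))"
    unfolding extend_def[of "tracks (induced g x)"] tracks_induced[OF coset_in[OF assms(1)]] ..
  also have "\<dots> = extend (tracks x) (h \<otimes> inv ?r \<otimes> (?r \<otimes> g))"
    using extend_equivariant[OF cocycle_in[OF assms(1)], of "?r \<otimes> g" "tracks x"] r assms(2)
      tracks_in[OF assms(3)] by simp
  also have "h \<otimes> inv ?r \<otimes> (?r \<otimes> g) = h \<otimes> g"
  proof -
    have "inv ?r \<otimes> (?r \<otimes> g) = g" using r assms(2) by (simp flip: m_assoc)
    thus ?thesis using r assms(1,2) by (simp add: m_assoc)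
  qed
  finally show ?thesis .
qed

lemma configuration_eqI:
  assumes "x \<in> topspace (full_shift (rcosets L \<rightarrow>\<^sub>E A))" "y \<in> topspace (full_shift (rcosets L \<rightarrow>\<^sub>E A))"
    and "\<And>c. c \<in> rcosets L \<Longrightarrow> tracks x c = tracks y c"
  shows "x = y"
proof
  fix i
  show "x i = y i"
    using assms(1,2) fun_cong[OF assms(3), of _ i]
    by (intro PiE_ext[of "x i" "rcosets L" "\<lambda>_. A" "y i"]) auto
qed

lemma induced_in:
  assumes "g \<in> carrier G" "x \<in> topspace (full_shift (rcosets L \<rightarrow>\<^sub>E A))"
  shows "induced g x \<in> topspace (full_shift (rcosets L \<rightarrow>\<^sub>E A))"
proof -
  have "extend (tracks x) (rep c \<otimes> g) i \<in> A" if "c \<in> rcosets L" for c i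
    using extend_in[of "rep c \<otimes> g" "tracks x"] tracks_in[OF assms(2)] rep_carrier[OF that] assms(1)
    by simp
  thus ?thesis by (simp add: induced_def)
qed

lemma coset_one: "L \<in> rcosets L"
  using coset_in[of \<one>] by (simp add: L.subset)

lemma continuous_map_induced:
  assumes g: "g \<in> carrier G"
  shows "continuous_map (full_shift (rcosets L \<rightarrow>\<^sub>E A)) (full_shift (rcosets L \<rightarrow>\<^sub>E A)) (induced g)"
    (is "continuous_map ?X ?X _")
proof (rule continuous_map_tracks[where K = "rcosets L" and p = "\<lambda>c d. d c" and B = "\<lambda>_. A"])
  fix c assume c: "c \<in> rcosets L"
  let ?h = "rep c \<otimes> g"
  have h: "?h \<in> carrier G" using rep_carrier[OF c] g by simp
  have "continuous_map ?X (full_shift A) (\<lambda>x i. x i (L #> ?h))"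
    using coset_in[OF h] by (intro continuous_map_letterwise) auto
  moreover have "continuous_map (full_shift A) (full_shift A) (\<rho> (?h \<otimes> inv (rep (L #> ?h))))"
    using cocycle_in[OF h] by (intro act.cont) simp
  ultimately have "continuous_map ?X (full_shift A) (\<lambda>x. extend (tracks x) ?h)"
    unfolding extend_def by (rule continuous_map_compose[unfolded o_def])
  thus "continuous_map ?X (full_shift A) (\<lambda>x i. induced g x i c)"
    using c by (simp add: induced_def)
next
  show "d = e" if "d \<in> rcosets L \<rightarrow>\<^sub>E A" "e \<in> rcosets L \<rightarrow>\<^sub>E A"
    "\<And>c. c \<in> rcosets L \<Longrightarrow> d c = e c" for d e
    using that by (rule PiE_ext)
qed (use finite_index coset_one induced_in[OF g] in auto)

definition induced_point :: "int \<Rightarrow> 'a set \<Rightarrow> 'c" where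
  "induced_point = (\<lambda>i. \<lambda>c\<in>rcosets L. if c = L then x0 i else z)"

lemma induced_point_in: "induced_point \<in> topspace (full_shift (rcosets L \<rightarrow>\<^sub>E A))"
  using act.point_in act.zero_in by (simp add: induced_point_def)

text \<open>
  The track of \<open>L\<close> is the only nonzero one. Comparing the two sides of the fixed-point equation
  on it shows first that the element sends this track to itself, so that it is in \<open>L\<close>, and
  then that a conjugate of it fixes \<open>x0\<close>; the conjugation appears because the chosen
  representative of \<open>L\<close> may differ from \<open>\<one>\<close>.
\<close>

lemma induced_stabilizer:
  assumes nz: "x0 \<noteq> (\<lambda>_. z)" and g: "g \<in> carrier G" and fixed: "induced g induced_point = induced_point"
  shows "g = \<one>"
proof -
  let ?r = "rep L" and ?h = "rep L \<otimes> g"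
  have r: "?r \<in> carrier G" "L #> ?r = L" using rep_carrier coset_rep coset_one by auto
  have rL: "?r \<in> L" using coset_join1[OF r(2,1) L.subgroup_axioms] .
  have h: "?h \<in> carrier G" using r g by simp
  have "extend (tracks induced_point) ?h = tracks (induced g induced_point) L"
    by (rule tracks_induced[OF coset_one, symmetric])
  also have "\<dots> = x0" unfolding fixed using coset_one by (simp add: induced_point_def)
  finally have x0: "\<rho> (?h \<otimes> inv (rep (L #> ?h))) (tracks induced_point (L #> ?h)) = x0"
    by (simp add: extend_def)
  have coset: "L #> ?h = L"
  proof (rule ccontr)
    assume "L #> ?h \<noteq> L"
    hence "tracks induced_point (L #> ?h) = (\<lambda>_. z)"
      using coset_in[OF h] by (simp add: induced_point_def)
    hence "x0 = (\<lambda>_. z)" using x0 act.fix_zero cocycle_in[OF h] by simp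
    thus False using nz by simp
  qed
  have "\<rho> (?h \<otimes> inv ?r) x0 = x0"
    using x0 coset_one unfolding coset by (simp add: induced_point_def)
  hence "?h \<otimes> inv ?r = \<one>"
    using act.stabilizer[of "?h \<otimes> inv ?r"] cocycle_in[OF h] unfolding coset by simp
  hence "?h = ?r" using h r by (metis inv_equality inv_inv inv_closed inv_inv)
  thus "g = \<one>" using r g by simp
qed

lemma pointy_act_induced:
  assumes "x0 \<noteq> (\<lambda>_. z)"
  shows "pointy_act G (rcosets L \<rightarrow>\<^sub>E A) (\<lambda>c\<in>rcosets L. z) induced induced_point"
proof (rule pointy_act.intro[OF is_group], unfold_locales)
  let ?X = "topspace (full_shift (rcosets L \<rightarrow>\<^sub>E A))"
  show "finite (rcosets L \<rightarrow>\<^sub>E A)" using finite_index act.finite_alphabet by (simp add: finite_PiE)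
  show "(\<lambda>c\<in>rcosets L. z) \<in> rcosets L \<rightarrow>\<^sub>E A" using act.zero_in by simp
  show "continuous_map (full_shift (rcosets L \<rightarrow>\<^sub>E A)) (full_shift (rcosets L \<rightarrow>\<^sub>E A)) (induced g)"
    if "g \<in> carrier G" for g using that by (rule continuous_map_induced)
  show "induced g (shift x) = shift (induced g x)" if g: "g \<in> carrier G" and x: "x \<in> ?X" for g x
  proof -
    have "extend (tracks (shift x)) h = shift (extend (tracks x) h)" if h: "h \<in> carrier G" for h
      using act.shift_commute[OF _ tracks_in[OF x coset_in[OF h]]] cocycle_in[OF h]
      by (simp add: extend_def shift_def)
    thus ?thesis
      using g rep_carrier by (auto simp: induced_def fun_eq_iff restrict_def)
  qed
  show "induced g (\<lambda>_. \<lambda>c\<in>rcosets L. z) = (\<lambda>_. \<lambda>c\<in>rcosets L. z)" if g: "g \<in> carrier G" for g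
  proof -
    have "extend (\<lambda>c i. (\<lambda>c\<in>rcosets L. z) c) h = (\<lambda>_. z)" if h: "h \<in> carrier G" for h
      using act.fix_zero cocycle_in[OF h] coset_in[OF h] by (simp add: extend_def)
    thus ?thesis using g rep_carrier by (auto simp: induced_def fun_eq_iff restrict_def)
  qed
  show "induced \<one> x = x" if x: "x \<in> ?X" for x
    using induced_in[OF one_closed x] x
    by (rule configuration_eqI)
      (simp only: tracks_induced r_one rep_carrier extend_rep tracks_in[OF x])
  show "induced (g \<otimes> h) x = induced g (induced h x)"
    if g: "g \<in> carrier G" and h: "h \<in> carrier G" and x: "x \<in> ?X" for g h x
  proof (rule configuration_eqI)
    show "induced (g \<otimes> h) x \<in> ?X" "induced g (induced h x) \<in> ?X"
      using g h x by (simp_all add: induced_in del: topspace_full_shift_iff)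
    show "tracks (induced (g \<otimes> h) x) c = tracks (induced g (induced h x)) c" if c: "c \<in> rcosets L" for c
      using g h rep_carrier[OF c]
      by (simp only: tracks_induced[OF c] extend_induced[OF _ h x] m_closed m_assoc)
  qed
  show "induced_point \<in> ?X" by (rule induced_point_in)
  have "{i. induced_point i \<noteq> (\<lambda>c\<in>rcosets L. z)} \<subseteq> {i. x0 i \<noteq> z}"
    by (auto simp: induced_point_def fun_eq_iff restrict_def split: if_splits)
  thus "finite_point (\<lambda>c\<in>rcosets L. z) induced_point"
    using act.point_finite unfolding finite_point_def by (rule finite_subset)
  show "g = \<one>" if "g \<in> carrier G" "induced g induced_point = induced_point" for g
    using assms that by (rule induced_stabilizer)
qed

end

section \<open>Closure properties\<close>

lemma admits_pointy_action_finite_index: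
  assumes "group H" "subgroup L H" "finite (rcosets\<^bsub>H\<^esub> L)" "admits_pointy_action (H\<lparr>carrier := L\<rparr>)"
  shows "admits_pointy_action H"
proof -
  have L: "group (H\<lparr>carrier := L\<rparr>)" using assms(1,2) by (simp add: subgroup.subgroup_is_group)
  obtain A :: "nat set" and z \<rho> x0 where "pointy_act (H\<lparr>carrier := L\<rparr>) A z \<rho> x0"
    using pointy_act_of_admits_pointy_action[OF L assms(4)] .
  then obtain A :: "nat set" and z \<rho> x0
    where act: "pointy_act (H\<lparr>carrier := L\<rparr>) A z \<rho> x0" "x0 \<noteq> (\<lambda>_. z)"
    using pointy_act_nonzero_point by blast
  interpret finite_index_pointy_act H L A z \<rho> x0
    using assms act(1)
    by (simp add: finite_index_pointy_act_def finite_index_pointy_act_axioms_def)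
  show ?thesis using pointy_act_induced[OF act(2)] by (rule admits_pointy_action_of_pointy_act)
qed

lemma admits_pointy_action_pullback:
  assumes "group G" "group K" "f \<in> hom K G" "inj_on f (carrier K)" "admits_pointy_action G"
  shows "admits_pointy_action K"
proof -
  obtain A :: "nat set" and z \<rho> x0 where "pointy_act G A z \<rho> x0"
    using pointy_act_of_admits_pointy_action[OF assms(1,5)] .
  from pointy_act.pullback[OF this assms(2-4)] show ?thesis
    by (rule admits_pointy_action_of_pointy_act)
qed

lemma admits_pointy_action_subgroup:
  assumes "group G" "subgroup K G" "admits_pointy_action G"
  shows "admits_pointy_action (G\<lparr>carrier := K\<rparr>)"
proof (rule admits_pointy_action_pullback[OF assms(1) _ _ _ assms(3)])
  show "group (G\<lparr>carrier := K\<rparr>)" using assms by (simp add: subgroup.subgroup_is_group)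
  show "id \<in> hom (G\<lparr>carrier := K\<rparr>) G"
    using subgroup.subset[OF assms(2)] by (auto intro!: homI)
qed simp

theorem lemma4:
  fixes G :: "('g, 'm) monoid_scheme" and H :: "('h, 'n) monoid_scheme"
  assumes "group G" and "group H"
  shows "(admits_pointy_action G \<and> admits_pointy_action H \<longrightarrow> admits_pointy_action (G \<times>\<times> H)) \<and>
    (\<forall>K. admits_pointy_action G \<and> subgroup K G \<longrightarrow> admits_pointy_action (G\<lparr>carrier := K\<rparr>)) \<and>
    (admits_pointy_action G \<and> commensurable G H \<longrightarrow> admits_pointy_action H)"
proof (intro conjI allI impI; elim conjE)
  assume GH: "admits_pointy_action G" "admits_pointy_action H"
  obtain A :: "nat set" and a \<rho> x0 where G: "pointy_act G A a \<rho> x0"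
    using pointy_act_of_admits_pointy_action[OF assms(1) GH(1)] .
  obtain B :: "nat set" and b \<tau> y0 where H: "pointy_act H B b \<tau> y0"
    using pointy_act_of_admits_pointy_action[OF assms(2) GH(2)] .
  show "admits_pointy_action (G \<times>\<times> H)"
    using pointy_act_DirProd[OF G H] by (rule admits_pointy_action_of_pointy_act)
next
  fix K assume "admits_pointy_action G" "subgroup K G"
  thus "admits_pointy_action (G\<lparr>carrier := K\<rparr>)"
    using admits_pointy_action_subgroup assms(1) by blast
next
  assume G: "admits_pointy_action G" and "commensurable G H"
  then obtain K L f where K: "subgroup K G" and L: "subgroup L H" "finite (rcosets\<^bsub>H\<^esub> L)"
    and f: "f \<in> iso (G\<lparr>carrier := K\<rparr>) (H\<lparr>carrier := L\<rparr>)"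
    unfolding commensurable_def is_iso_def by blast
  have groups: "group (G\<lparr>carrier := K\<rparr>)" "group (H\<lparr>carrier := L\<rparr>)"
    using assms K L by (simp_all add: subgroup.subgroup_is_group)
  have "inv_into (carrier (G\<lparr>carrier := K\<rparr>)) f \<in> iso (H\<lparr>carrier := L\<rparr>) (G\<lparr>carrier := K\<rparr>)"
    using group.iso_set_sym[OF groups(1) f] .
  hence "admits_pointy_action (H\<lparr>carrier := L\<rparr>)"
    using admits_pointy_action_pullback[OF groups] admits_pointy_action_subgroup[OF assms(1) K G]
    unfolding iso_iff by blast
  thus "admits_pointy_action H"
    by (rule admits_pointy_action_finite_index[OF assms(2) L])
qed

end
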